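(* For any graph $G$, \[ \frac{\operatorname{dom}_g(G,A)-1}{2}\leq \operatorname{dom}_g(G,B)\leq 2\cdot \operatorname{dom}_g(G,A)+1, \] and \[ \frac{\operatorname{dom}_g(G,B)-1}{2}\leq \operatorname{dom}_g(G,A)\leq 2\cdot \operatorname{dom}_g(G,B)+1. \]
   Context: All graphs are finite and simple. A set $S\subseteq V(G)$ is dominating if every vertex of $G$ is in $S$ or adjacent to a vertex of $S$. The domatic game on $G$ with palette size $k$: players Alice and Bob alternately choose an uncolored vertex of $G$ and color it with a color from $[k]=\{1,\dots,k\}$, until every vertex is colored. Alice wins if for every $c\in[k]$ the set of vertices colored $c$ is a dominating set of $G$; otherwise Bob wins. For $X\in\{A,B\}$, $X$ indicates who moves first ($A$ = Alice, $B$ = Bob). The domatic game number $\operatorname{dom}_g(G,X)$ is the largest $k$ such that Alice has a winning strategy in the domatic game on $G$ with palette size $k$ when $X$ moves first. *)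

theory Defs
  imports Complex_Main "Graph_Theory.Digraph"
begin

text \<open>
  A finite simple graph is an element of the locale \<^locale>\<open>graph\<close> of \<^theory>\<open>Graph_Theory.Digraph\<close>:
  finite, loop-free, without parallel arcs, and symmetric, each undirected edge being a pair of
  opposite arcs.  \<open>u \<rightarrow>\<^bsub>G\<^esub> v\<close> is adjacency.
\<close>

definition dominating_set :: "('a, 'b) pre_digraph \<Rightarrow> 'a set \<Rightarrow> bool" where
  "dominating_set G S \<longleftrightarrow>
     S \<subseteq> verts G \<and> (\<forall>v \<in> verts G. v \<in> S \<or> (\<exists>u \<in> S. u \<rightarrow>\<^bsub>G\<^esub> v))"

datatype player = Alice | Bob

text \<open>
  A play is the chronological list of the moves made so far; the move \<open>(v, c)\<close> colours vertex \<open>v\<close>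
  with colour \<open>c\<close>.
\<close>

type_synonym 'a play = "('a \<times> nat) list"

definition legal_play :: "('a, 'b) pre_digraph \<Rightarrow> nat \<Rightarrow> 'a play \<Rightarrow> bool" where
  "legal_play G k p \<longleftrightarrow> distinct (map fst p) \<and> set p \<subseteq> verts G \<times> {1..k}"

definition complete_play :: "('a, 'b) pre_digraph \<Rightarrow> nat \<Rightarrow> 'a play \<Rightarrow> bool" where
  "complete_play G k p \<longleftrightarrow> legal_play G k p \<and> fst ` set p = verts G"

definition color_class :: "'a play \<Rightarrow> nat \<Rightarrow> 'a set" where
  "color_class p c = {v. (v, c) \<in> set p}"

definition won_by_Alice :: "('a, 'b) pre_digraph \<Rightarrow> nat \<Rightarrow> 'a play \<Rightarrow> bool" where
  "won_by_Alice G k p \<longleftrightarrow> (\<forall>c \<in> {1..k}. dominating_set G (color_class p c))"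

fun opponent :: "player \<Rightarrow> player" where
  "opponent Alice = Bob"
| "opponent Bob = Alice"

text \<open>The player whose turn it is after the play \<open>p\<close>, if \<open>X\<close> made (or makes) the first move.\<close>

definition to_move :: "player \<Rightarrow> 'a play \<Rightarrow> player" where
  "to_move X p = (if even (length p) then X else opponent X)"

text \<open>
  A strategy of Alice maps the play so far to her next move; only its values on plays in which it
  is her turn matter.
\<close>

type_synonym 'a strategy = "'a play \<Rightarrow> 'a \<times> nat"

definition follows :: "player \<Rightarrow> 'a strategy \<Rightarrow> 'a play \<Rightarrow> bool" where
  "follows X \<sigma> p \<longleftrightarrow>
     (\<forall>i < length p. to_move X (take i p) = Alice \<longrightarrow> p ! i = \<sigma> (take i p))"

definition winning_strategy ::
    "('a, 'b) pre_digraph \<Rightarrow> nat \<Rightarrow> player \<Rightarrow> 'a strategy \<Rightarrow> bool" where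
  "winning_strategy G k X \<sigma> \<longleftrightarrow>
     (\<forall>p. legal_play G k p \<and> follows X \<sigma> p \<and> \<not> complete_play G k p \<and> to_move X p = Alice
        \<longrightarrow> legal_play G k (p @ [\<sigma> p])) \<and>
     (\<forall>p. complete_play G k p \<and> follows X \<sigma> p \<longrightarrow> won_by_Alice G k p)"

definition Alice_wins_game :: "('a, 'b) pre_digraph \<Rightarrow> nat \<Rightarrow> player \<Rightarrow> bool" where
  "Alice_wins_game G k X \<longleftrightarrow> (\<exists>\<sigma>. winning_strategy G k X \<sigma>)"

text \<open>
  For a graph with at least one vertex the maximum exists: Alice wins with one colour, and she
  loses as soon as there are more colours than vertices (see below).  On the null graph she wins
  with every palette, so there is no largest \<open>k\<close>; the value is then an unspecified number that is
  the same for both choices of \<open>X\<close>.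
\<close>

definition dom_g :: "('a, 'b) pre_digraph \<Rightarrow> player \<Rightarrow> nat" where
  "dom_g G X = (GREATEST k. Alice_wins_game G k X)"

lemma legal_play_Nil [simp]: "legal_play G k []"
  by (simp add: legal_play_def)

lemma legal_play_snoc:
  "legal_play G k (p @ [(v, c)]) \<longleftrightarrow>
     legal_play G k p \<and> v \<in> verts G \<and> v \<notin> fst ` set p \<and> c \<in> {1..k}"
  by (auto simp: legal_play_def)

lemma follows_snoc:
  "follows X \<sigma> (p @ [m]) \<longleftrightarrow> follows X \<sigma> p \<and> (to_move X p = Alice \<longrightarrow> m = \<sigma> p)"
  by (auto simp: follows_def nth_append less_Suc_eq)

lemma length_legal_play:
  assumes "finite (verts G)" "legal_play G k p"
  shows "length p \<le> card (verts G)"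
proof -
  have "length p = card (set (map fst p))"
    using assms(2) by (metis distinct_card legal_play_def length_map)
  also have "\<dots> \<le> card (verts G)"
    using assms by (intro card_mono) (auto simp: legal_play_def)
  finally show ?thesis .
qed

lemma incomplete_playE:
  assumes "legal_play G k p" "\<not> complete_play G k p"
  obtains v where "v \<in> verts G" "v \<notin> fst ` set p"
proof -
  have "fst ` set p \<subseteq> verts G"
    using assms(1) by (auto simp: legal_play_def)
  moreover have "fst ` set p \<noteq> verts G"
    using assms by (simp add: complete_play_def)
  ultimately show thesis using that by blast
qed

lemma Alice_wins_one_color:
  assumes "graph G"
  shows "Alice_wins_game G 1 X"
proof -
  define \<sigma> :: "'a strategy" where "\<sigma> p = (SOME v. v \<in> verts G - fst ` set p, 1)" for p
  have "winning_strategy G 1 X \<sigma>"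
    unfolding winning_strategy_def
  proof (intro conjI allI impI; elim conjE)
    fix p assume p: "legal_play G 1 p" "\<not> complete_play G 1 p"
    then have "\<exists>v. v \<in> verts G - fst ` set p"
      by (metis Diff_iff incomplete_playE)
    then have "(SOME v. v \<in> verts G - fst ` set p) \<in> verts G - fst ` set p"
      by (rule someI_ex)
    then show "legal_play G 1 (p @ [\<sigma> p])"
      using p by (simp add: \<sigma>_def legal_play_snoc)
  next
    fix p assume "complete_play G 1 p"
    then have img: "fst ` set p = verts G" and one: "\<And>v c. (v, c) \<in> set p \<Longrightarrow> c = 1"
      by (auto simp: complete_play_def legal_play_def)
    have "color_class p 1 = fst ` set p"
      unfolding color_class_def using one by force
    then have "color_class p 1 = verts G" using img by simp
    then show "won_by_Alice G 1 p"
      by (auto simp: won_by_Alice_def dominating_set_def)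
  qed
  then show ?thesis by (auto simp: Alice_wins_game_def)
qed

lemma complete_play_exists:
  assumes "graph G" "winning_strategy G k X \<sigma>" "k \<ge> 1"
  obtains p where "complete_play G k p" "follows X \<sigma> p"
proof -
  interpret graph G by fact
  let ?P = "\<lambda>p. legal_play G k p \<and> follows X \<sigma> p"
  have "\<exists>p. ?P p \<and> (\<forall>q. ?P q \<longrightarrow> length q \<le> length p)"
    by (rule ex_has_greatest_nat[where k = "[]" and b = "Suc (card (verts G))"])
       (auto simp: follows_def length_legal_play less_Suc_eq_le)
  then obtain p where p: "?P p" and maximal: "\<And>q. ?P q \<Longrightarrow> length q \<le> length p"
    by blast
  have "complete_play G k p"
  proof (rule ccontr)
    assume incomplete: "\<not> complete_play G k p"
    have "\<exists>m. ?P (p @ [m])"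
    proof (cases "to_move X p = Alice")
      case True
      then have "legal_play G k (p @ [\<sigma> p])"
        using p incomplete assms(2) unfolding winning_strategy_def by blast
      then have "?P (p @ [\<sigma> p])"
        using p by (simp add: follows_snoc)
      then show ?thesis by blast
    next
      case False
      obtain v where "v \<in> verts G" "v \<notin> fst ` set p"
        using p incomplete incomplete_playE by blast
      then have "?P (p @ [(v, 1)])"
        using p False assms(3) by (simp add: legal_play_snoc follows_snoc)
      then show ?thesis by blast
    qed
    then obtain m where "?P (p @ [m])" by blast
    from maximal[OF this] show False by simp
  qed
  with p that show thesis by blast
qed

lemma Alice_wins_game_le_card:
  assumes "graph G" "verts G \<noteq> {}" "Alice_wins_game G k X"
  shows "k \<le> card (verts G)"
proof (cases "k = 0")
  case False
  interpret graph G by fact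
  obtain \<sigma> where \<sigma>: "winning_strategy G k X \<sigma>"
    using assms(3) by (auto simp: Alice_wins_game_def)
  obtain p where p: "complete_play G k p" "follows X \<sigma> p"
    using complete_play_exists[OF assms(1) \<sigma>] False by auto
  have "won_by_Alice G k p"
    using \<sigma> p by (auto simp: winning_strategy_def)
  have "{1..k} \<subseteq> snd ` set p"
  proof
    fix c assume "c \<in> {1..k}"
    then have "dominating_set G (color_class p c)"
      using \<open>won_by_Alice G k p\<close> by (auto simp: won_by_Alice_def)
    then have "color_class p c \<noteq> {}"
      using assms(2) by (auto simp: dominating_set_def)
    then show "c \<in> snd ` set p" by (force simp: color_class_def)
  qed
  then have "card {1..k} \<le> card (snd ` set p)"
    by (intro card_mono) auto
  also have "\<dots> \<le> length p"
    by (meson card_image_le card_length finite_set le_trans)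
  also have "\<dots> \<le> card (verts G)"
    using p by (auto intro: length_legal_play simp: complete_play_def)
  finally show ?thesis by simp
qed simp

end

theory Submission
  imports Defs
begin

text \<open>
  In fact the two numbers differ by at most one.  If Alice wins with \<open>k + 1\<close> colours, she wins in
  particular against a Bob who always uses one fixed colour \<open>d\<close>; then her own moves alone make the
  other \<open>k\<close> colour classes dominating.  In the game in which only Alice's moves count, an additional
  free vertex never hurts Alice, and so neither does having the move instead of Bob.  Conversely, if
  Alice is the first to move, take for \<open>d\<close> the colour of her first move: that move then counts for
  nothing and may be omitted.
\<close>

section \<open>The game in which only Alice's moves count\<close>

text \<open>
  \<open>tally_wins G k P U M\<close>: Alice wins from the position where \<open>P\<close> is to move, \<open>U\<close> is the set of
  uncoloured vertices and only the moves recorded in \<open>M\<close> count; moves of Bob are not recorded.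
  Alice may use colours outside \<open>{1..k}\<close>, which count for nothing.
\<close>

inductive tally_wins ::
    "('a, 'b) pre_digraph \<Rightarrow> nat \<Rightarrow> player \<Rightarrow> 'a set \<Rightarrow> ('a \<times> nat) set \<Rightarrow> bool"
  for G :: "('a, 'b) pre_digraph" and k :: nat where
  finished: "(\<And>c v. c \<in> {1..k} \<Longrightarrow> v \<in> verts G \<Longrightarrow> \<exists>u. (u, c) \<in> M \<and> (u = v \<or> u \<rightarrow>\<^bsub>G\<^esub> v))
    \<Longrightarrow> tally_wins G k P {} M"
| Alice_moves: "v \<in> U \<Longrightarrow> tally_wins G k Bob (U - {v}) (insert (v, c) M)
    \<Longrightarrow> tally_wins G k Alice U M"
| Bob_moves: "U \<noteq> {} \<Longrightarrow> (\<And>v. v \<in> U \<Longrightarrow> tally_wins G k Alice (U - {v}) M)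
    \<Longrightarrow> tally_wins G k Bob U M"

text \<open>The record enters only the final test, which is monotone in it and ignores colours
  outside \<open>{1..k}\<close>; so Alice can repeat the same moves. This allows deleting void
  entries and adding Bob's.\<close>

lemma tally_wins_mono:
  assumes "tally_wins G k P U M" "\<And>v c. (v, c) \<in> M \<Longrightarrow> c \<in> {1..k} \<Longrightarrow> (v, c) \<in> N"
  shows "tally_wins G k P U N"
  using assms
proof (induction arbitrary: N rule: tally_wins.induct)
  case (finished M P)
  then show ?case by (metis tally_wins.finished)
next
  case (Alice_moves v U c M)
  have "tally_wins G k Bob (U - {v}) (insert (v, c) N)"
    by (rule Alice_moves.IH) (use Alice_moves.prems in auto)
  with Alice_moves.hyps(1) show ?case by (rule tally_wins.Alice_moves)
next
  case (Bob_moves U M)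
  then show ?case by (simp add: tally_wins.Bob_moves)
qed

text \<open>The two claims are proved simultaneously because each needs the other one move later.\<close>

lemma tally_wins_extra:
  assumes "tally_wins G k P U M"
  shows "(\<forall>y. tally_wins G k P (insert y U) M) \<and> tally_wins G k Alice U M"
  using assms
proof (induction rule: tally_wins.induct)
  case (finished M P)
  have fin: "tally_wins G k Q {} N" if "M \<subseteq> N" for Q N
    by (rule tally_wins.finished) (use finished that in blast)
  have "tally_wins G k P {y} M" for y
  proof (cases P)
    case Alice
    \<comment> \<open>The extra vertex forces one more move by Alice; \<open>0\<close> lies outside
      the palette, so the move is void.\<close>
    have "tally_wins G k Bob ({y} - {y}) (insert (y, 0) M)"
      using fin[of "insert (y, 0) M" Bob] by auto
    with Alice show ?thesis
      by (metis insertI1 tally_wins.Alice_moves)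
  next
    case Bob
    then show ?thesis
      using fin by (auto intro: tally_wins.Bob_moves)
  qed
  then show ?case using fin by blast
next
  case (Alice_moves v U c M)
  have "tally_wins G k Alice (insert y U) M" for y
  proof (cases "y = v")
    case True
    then show ?thesis
      using Alice_moves by (metis insert_absorb tally_wins.Alice_moves)
  next
    case False
    then have "insert y U - {v} = insert y (U - {v})" by blast
    then show ?thesis
      using Alice_moves by (metis insertI2 tally_wins.Alice_moves)
  qed
  then show ?case
    using Alice_moves by (metis tally_wins.Alice_moves)
next
  case (Bob_moves U M)
  \<comment> \<open>Let Bob take any \<open>w\<close>: Alice is then to move on
    \<open>U - {w}\<close>, and by induction \<open>w\<close> can be handed back as an extra free
    vertex.\<close>
  obtain w where "w \<in> U" using Bob_moves.hyps(1) by blast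
  then have "tally_wins G k Alice (insert w (U - {w})) M"
    using Bob_moves.IH by blast
  with \<open>w \<in> U\<close> have tempo: "tally_wins G k Alice U M"
    by (simp add: insert_absorb)
  have "tally_wins G k Bob (insert y U) M" for y
  proof (cases "y \<in> U")
    case True
    then show ?thesis
      using Bob_moves.hyps by (auto simp: insert_absorb intro: tally_wins.Bob_moves)
  next
    case False
    show ?thesis
    proof (rule tally_wins.Bob_moves)
      fix x assume x: "x \<in> insert y U"
      show "tally_wins G k Alice (insert y U - {x}) M"
      proof (cases "x = y")
        \<comment> \<open>If Bob spends his move on the extra vertex, Alice faces the old position
          with the move, which is \<open>tempo\<close>.\<close>
        case True
        then show ?thesis using tempo False by simp
      next
        case False
        then have "insert y U - {x} = insert y (U - {x})" by blast
        then show ?thesis using x False Bob_moves.IH by auto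
      qed
    qed simp
  qed
  with tempo show ?case by blast
qed

lemmas tally_wins_insert = tally_wins_extra[THEN conjunct1, rule_format]
  and tally_wins_tempo = tally_wins_extra[THEN conjunct2]

section \<open>Passing between the two games\<close>

text \<open>
  Maps the palette \<open>{1..Suc k}\<close> without \<open>d\<close> onto \<open>{1..k}\<close>, and \<open>d\<close> to \<open>0\<close>, which is not a colour.
\<close>

definition drop_color :: "nat \<Rightarrow> nat \<Rightarrow> nat" where
  "drop_color d c = (if c < d then c else if c = d then 0 else c - 1)"

lemma drop_color_self [simp]: "drop_color d d = 0"
  by (simp add: drop_color_def)

lemma drop_color_surj:
  assumes "e \<in> {1..k}"
  obtains c where "c \<in> {1..Suc k}" "drop_color d c = e"
proof (cases "e < d")
  case True
  then show ?thesis using assms that[of e] by (simp add: drop_color_def)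
next
  case False
  then show ?thesis using assms that[of "Suc e"] by (simp add: drop_color_def)
qed

lemma to_move_snoc [simp]: "to_move X (p @ [m]) = opponent (to_move X p)"
  by (cases X) (auto simp: to_move_def)

lemma legal_play_uncolored_snoc:
  "legal_play G k (p @ [(v, c)]) \<Longrightarrow>
     v \<in> verts G - fst ` set p
     \<and> verts G - fst ` set (p @ [(v, c)]) = verts G - fst ` set p - {v}"
  by (auto simp: legal_play_snoc)

text \<open>From \<open>p\<close> on, Alice plays \<open>\<sigma>\<close> against an imagined Bob
  who uses only \<open>d\<close>. The play ends with all classes dominating, and those of colours
  other than \<open>d\<close> owe nothing to Bob's moves after \<open>p\<close>.\<close>

lemma winning_strategy_imp_tally_wins:
  assumes "finite (verts G)" "winning_strategy G (Suc k) X \<sigma>" "d \<in> {1..Suc k}"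
    and "legal_play G (Suc k) p" "follows X \<sigma> p"
  shows "tally_wins G k (to_move X p) (verts G - fst ` set p) (map_prod id (drop_color d) ` set p)"
  using assms(4,5)
proof (induction "card (verts G - fst ` set p)" arbitrary: p rule: less_induct)
  case less
  let ?U = "\<lambda>p. verts G - fst ` set p"
  let ?M = "\<lambda>p. map_prod id (drop_color d) ` set p"
  have next_move: "tally_wins G k (opponent (to_move X p)) (?U p - {v})
                     (insert (v, drop_color d c) (?M p)) \<and> v \<in> ?U p"
    if "legal_play G (Suc k) (p @ [(v, c)])" "follows X \<sigma> (p @ [(v, c)])" for v c
  proof -
    have v: "v \<in> ?U p" and U: "?U (p @ [(v, c)]) = ?U p - {v}"
      using legal_play_uncolored_snoc[OF that(1)] by auto
    have "card (?U (p @ [(v, c)])) < card (?U p)"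
      unfolding U using v assms(1) by (intro card_Diff1_less) auto
    from less.hyps[OF this that] v U show ?thesis by simp
  qed
  show ?case
  proof (cases "complete_play G (Suc k) p")
    case True
    then have won: "won_by_Alice G (Suc k) p"
      using assms(2) less.prems by (auto simp: winning_strategy_def)
    have "tally_wins G k (to_move X p) {} (?M p)"
    proof (rule tally_wins.finished)
      fix e v assume "e \<in> {1..k}" and v: "v \<in> verts G"
      then obtain c where c: "c \<in> {1..Suc k}" "drop_color d c = e"
        using drop_color_surj by blast
      then have "dominating_set G (color_class p c)"
        using won by (simp add: won_by_Alice_def)
      then obtain u where "(u, c) \<in> set p" "u = v \<or> u \<rightarrow>\<^bsub>G\<^esub> v"
        using v by (auto simp: dominating_set_def color_class_def)
      then show "\<exists>u. (u, e) \<in> ?M p \<and> (u = v \<or> u \<rightarrow>\<^bsub>G\<^esub> v)"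
        using c by force
    qed
    moreover have "?U p = {}" using True by (simp add: complete_play_def)
    ultimately show ?thesis by metis
  next
    case incomplete: False
    show ?thesis
    proof (cases "to_move X p")
      case Alice
      obtain v c where m: "\<sigma> p = (v, c)" by fastforce
      have "legal_play G (Suc k) (p @ [(v, c)])"
        using assms(2) less.prems incomplete Alice m unfolding winning_strategy_def by metis
      moreover have "follows X \<sigma> (p @ [(v, c)])"
        using less.prems m by (simp add: follows_snoc)
      ultimately show ?thesis
        using next_move[of v c] Alice by (auto intro: tally_wins.Alice_moves)
    next
      case Bob
      have "tally_wins G k Alice (?U p - {v}) (?M p)" if "v \<in> ?U p" for v
      proof -
        \<comment> \<open>Bob's imagined answer is recorded with colour \<open>0\<close>, so
          monotonicity removes it.\<close>
        have "legal_play G (Suc k) (p @ [(v, d)])" "follows X \<sigma> (p @ [(v, d)])"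
          using less.prems that assms(3) Bob by (auto simp: legal_play_snoc follows_snoc)
        then have "tally_wins G k Alice (?U p - {v}) (insert (v, 0) (?M p))"
          using next_move[of v d] Bob by simp
        then show ?thesis by (rule tally_wins_mono) auto
      qed
      moreover have "?U p \<noteq> {}"
        using incomplete_playE[OF less.prems(1) incomplete] by blast
      ultimately show ?thesis
        using Bob by (metis tally_wins.Bob_moves)
    qed
  qed
qed

text \<open>Alice keeps the position winning in the tally game while the whole play, Bob's moves
  included, serves as the record; the additional entries can only help.\<close>

lemma tally_wins_imp_Alice_wins_game:
  assumes "k > 0" "tally_wins G k X (verts G) {}"
  shows "Alice_wins_game G k X"
proof -
  let ?W = "\<lambda>P p. tally_wins G k P (verts G - fst ` set p) (set p)"
  define \<sigma> where
    "\<sigma> p = (SOME m. legal_play G k (p @ [m]) \<and> ?W Bob (p @ [m]))" for p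
  have \<sigma>: "legal_play G k (p @ [\<sigma> p]) \<and> ?W Bob (p @ [\<sigma> p])"
    if p: "legal_play G k p" "\<not> complete_play G k p" and W: "?W Alice p" for p
  proof -
    have "verts G - fst ` set p \<noteq> {}"
      using incomplete_playE[OF p] by blast
    with W obtain v c where v: "v \<in> verts G - fst ` set p"
      and W': "tally_wins G k Bob (verts G - fst ` set p - {v}) (insert (v, c) (set p))"
      by cases blast+
    \<comment> \<open>A void colour is not legal in the real game; colour \<open>1\<close> replaces
      it, which is where \<open>k > 0\<close> enters.\<close>
    define e where "e = (if c \<in> {1..k} then c else 1)"
    have legal: "legal_play G k (p @ [(v, e)])"
      using p v assms(1) by (auto simp: legal_play_snoc e_def)
    have "tally_wins G k Bob (verts G - fst ` set p - {v}) (set (p @ [(v, e)]))"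
      by (rule tally_wins_mono[OF W']) (auto simp: e_def)
    then have "?W Bob (p @ [(v, e)])"
      using legal_play_uncolored_snoc[OF legal] by simp
    with legal show ?thesis
      unfolding \<sigma>_def by (intro someI_ex[where P = "\<lambda>m. legal_play G k (p @ [m]) \<and> ?W Bob (p @ [m])"]) blast
  qed
  have invariant: "?W (to_move X p) p" if "legal_play G k p" "follows X \<sigma> p" for p
    using that
  proof (induction p rule: rev_induct)
    case Nil
    then show ?case using assms(2) by (simp add: to_move_def)
  next
    case (snoc m p)
    obtain v c where m: "m = (v, c)" by fastforce
    have p: "legal_play G k p" "follows X \<sigma> p"
      and v: "v \<in> verts G - fst ` set p"
      and U: "verts G - fst ` set (p @ [m]) = verts G - fst ` set p - {v}"
      using snoc.prems legal_play_uncolored_snoc[of G k p v c]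
      by (auto simp: m legal_play_snoc follows_snoc)
    have incomplete: "\<not> complete_play G k p"
      using v by (auto simp: complete_play_def)
    have W: "?W (to_move X p) p" using snoc.IH p by blast
    show ?case
    proof (cases "to_move X p")
      case Alice
      moreover have "m = \<sigma> p" using snoc.prems(2) Alice by (simp add: follows_snoc)
      ultimately show ?thesis using \<sigma>[OF p(1) incomplete] W by simp
    next
      case Bob
      then have "tally_wins G k Alice (verts G - fst ` set p - {v}) (set p)"
        using W v by (auto elim: tally_wins.cases)
      then have "tally_wins G k Alice (verts G - fst ` set p - {v}) (set (p @ [m]))"
        by (rule tally_wins_mono) auto
      then show ?thesis unfolding U to_move_snoc Bob by simp
    qed
  qed
  have "won_by_Alice G k p" if "complete_play G k p" "follows X \<sigma> p" for p
  proof -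
    have legal: "legal_play G k p" and U: "verts G - fst ` set p = {}"
      using that by (auto simp: complete_play_def)
    have "tally_wins G k (to_move X p) {} (set p)"
      using invariant[OF legal that(2)] U by simp
    then have "\<exists>u. (u, c) \<in> set p \<and> (u = v \<or> u \<rightarrow>\<^bsub>G\<^esub> v)" if "c \<in> {1..k}" "v \<in> verts G" for c v
      by (cases rule: tally_wins.cases) (use that in auto)
    then show ?thesis
      using legal unfolding won_by_Alice_def dominating_set_def color_class_def legal_play_def
      by fast
  qed
  then have "winning_strategy G k X \<sigma>"
    using \<sigma> invariant unfolding winning_strategy_def by metis
  then show ?thesis by (auto simp: Alice_wins_game_def)
qed

section \<open>Comparing the two domatic game numbers\<close>

lemma Alice_wins_game_drop_color:
  assumes "graph G" "verts G \<noteq> {}" "k > 0" "Alice_wins_game G (Suc k) X"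
  shows "Alice_wins_game G k Y"
proof -
  interpret graph G by fact
  obtain \<sigma> where \<sigma>: "winning_strategy G (Suc k) X \<sigma>"
    using assms(4) by (auto simp: Alice_wins_game_def)
  note tally = winning_strategy_imp_tally_wins[OF finite_verts \<sigma>]
  have Bob_first: "tally_wins G k Bob (verts G) {}"
  proof (cases X)
    case Bob
    then show ?thesis
      \<comment> \<open>No move has been made yet, so any colour can serve as
        \<open>d\<close>.\<close>
      using tally[of 1 "[]"] by (simp add: follows_def to_move_def)
  next
    case Alice
    obtain v d where m: "\<sigma> [] = (v, d)" by fastforce
    have "\<not> complete_play G (Suc k) []"
      using assms(2) by (simp add: complete_play_def)
    then have legal: "legal_play G (Suc k) [(v, d)]"
      using \<sigma> Alice m unfolding winning_strategy_def
      by (metis append_Nil even_zero follows_def length_greater_0_conv legal_play_Nil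
          length_0_conv less_nat_zero_code to_move_def)
    then have v: "v \<in> verts G" and d: "d \<in> {1..Suc k}"
      by (auto simp: legal_play_def)
    have "tally_wins G k Bob (verts G - {v}) {(v, 0)}"
      using tally[OF d legal] m Alice by (simp add: follows_def to_move_def)
    then have "tally_wins G k Bob (verts G - {v}) {}"
      by (rule tally_wins_mono) auto
    then have "tally_wins G k Bob (insert v (verts G - {v})) {}"
      by (rule tally_wins_insert)
    then show ?thesis
      using v by (simp add: insert_absorb)
  qed
  then have "tally_wins G k Y (verts G) {}"
    by (cases Y) (auto intro: tally_wins_tempo)
  with assms(3) show ?thesis
    by (rule tally_wins_imp_Alice_wins_game)
qed

text \<open>Here both game numbers are the greatest element of the same constantly true predicate,
  hence equal although unspecified.\<close>

lemma Alice_wins_game_null_graph: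
  assumes "verts G = {}"
  shows "Alice_wins_game G k X"
proof -
  have "winning_strategy G k X \<sigma>" for \<sigma>
    using assms
    by (auto simp: winning_strategy_def complete_play_def legal_play_def won_by_Alice_def
        dominating_set_def color_class_def)
  then show ?thesis by (auto simp: Alice_wins_game_def)
qed

lemma dom_g_le_Suc_dom_g:
  assumes "graph G"
  shows "dom_g G X \<le> Suc (dom_g G Y)"
proof (cases "verts G = {}")
  case True
  then show ?thesis by (simp add: dom_g_def Alice_wins_game_null_graph)
next
  case False
  note bound = Alice_wins_game_le_card[OF assms False]
  have wins: "Alice_wins_game G (dom_g G X) X"
    unfolding dom_g_def using Alice_wins_one_color[OF assms] bound by (rule GreatestI_nat)
  show ?thesis
  \<comment> \<open>Dropping a colour must leave at least one; for values up to \<open>1\<close> the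
    bound is trivial.\<close>
  proof (cases "dom_g G X \<le> 1")
    case False
    then obtain k where k: "dom_g G X = Suc k" "k > 0"
      by (metis One_nat_def not0_implies_Suc not_gr0 le_SucI zero_le order_refl)
    then have "Alice_wins_game G k Y"
      using Alice_wins_game_drop_color assms \<open>verts G \<noteq> {}\<close> wins by metis
    then have "k \<le> dom_g G Y"
      unfolding dom_g_def using bound by (rule Greatest_le_nat)
    with k show ?thesis by simp
  qed simp
qed

theorem theorem3p7:
  fixes G :: "('a, 'b) pre_digraph"
  assumes "graph G"
  shows "((real (dom_g G Alice) - 1) / 2 \<le> real (dom_g G Bob)
          \<and> real (dom_g G Bob) \<le> 2 * real (dom_g G Alice) + 1)
       \<and> ((real (dom_g G Bob) - 1) / 2 \<le> real (dom_g G Alice)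
          \<and> real (dom_g G Alice) \<le> 2 * real (dom_g G Bob) + 1)"
  using dom_g_le_Suc_dom_g[OF assms, of Alice Bob] dom_g_le_Suc_dom_g[OF assms, of Bob Alice]
  by (simp add: field_simps)

end
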